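(* Let $\{x_k\}_{k\ge1}$ be generated by the projected subgradient method with initial point $x_1\in\mathcal{T}_{1/2}$ and nonsummable diminishing step-sizes $\alpha_k$, i.e. $\alpha_k\ge0$, $\lim_{k\to\infty}\alpha_k=0$, $\sum_{k=1}^\infty\alpha_k=\infty$, satisfying in addition, for all $k$, $$0<\alpha_k<\min\left\{1,\ \min\Big\{1,\frac{\mu}{L}\Big\}\Big(\frac{\mu}{2\rho}\Big)^{\frac1{\delta(1+\nu)-1}}\right\}.$$ Then, with $f_k^*:=\min\{f(x_i):i=1,\dots,k\}$, $$\lim_{k\to\infty}f_k^*=f^*,\qquad\liminf_{k\to\infty}f(x_k)=f^*,\qquad\liminf_{k\to\infty}\operatorname{dist}(x_k;\mathcal{X}^* )=0.$$ Moreover, if $\{x_k\}_{k\ge1}$ is a bounded sequence, then it has a subsequence converging to some optimal solution $x^*\in\mathcal{X}^*$.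
   Context: $\|\cdot\|$ is the Euclidean norm on $\mathbb{R}^n$, $\operatorname{dist}(x;S)=\inf_{z\in S}\|z-x\|$, $\operatorname{proj}_X$ is the Euclidean projection onto $X$, $\operatorname{dom}(f)=\{x:f(x)<+\infty\}$, and $\partial f$ is the Clarke subdifferential. Standing assumptions: $f:\mathbb{R}^n\to\mathbb{R}\cup\{+\infty\}$ is proper; $X\subseteq\operatorname{dom}(f)$ is nonempty, closed and convex; the set of minimizers $\mathcal{X}^*=\operatorname{argmin}_{x\in X}f(x)$ is nonempty and $f^*$ is the minimal value of $f$ over $X$. The parameters satisfy $\rho>0$, $0<\nu\le1$, $\frac1{1+\nu}<\delta\le1$, $\mu>0$, and: (i) $f$ is $\nu$-paraconvex with constant $\rho$ on an open convex set $X'$ with $X\subseteq X'\subseteq\operatorname{dom}(f)$, i.e. $f(\lambda x+(1-\lambda)y)\le\lambda f(x)+(1-\lambda)f(y)+\rho\min\{\lambda,1-\lambda\}\|x-y\|^{1+\nu}$ for all $x,y\in X'$, $\lambda\in[0,1]$ (consequently $f$ is locally Lipschitz on $X'$); (ii) Hölderian error bound: $\mu\operatorname{dist}^{1/\delta}(x;\mathcal{X}^* )\le f(x)-f^*$ for all $x\in X$. For $\gamma\in(0,1]$ let $\mathcal{T}_\gamma=\big\{x\in X:\operatorname{dist}(x;\mathcal{X}^* )<(\gamma\mu/\rho)^{\delta/(\delta(1+\nu)-1)}\big\}$. Let $L=\sup\{\|\zeta\|:\zeta\in\partial f(x),\ x\in\mathcal{T}_1\}$, with $0<L<\infty$. Projected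 subgradient method with step-sizes $\alpha_k$: from the initial point, at each iteration choose any $\zeta_k\in\partial f(x_k)$ and set $x_{k+1}=\operatorname{proj}_X\big(x_k-\alpha_k\zeta_k/\|\zeta_k\|\big)$; if $\zeta_k=0$, set $x_{k+1}=x_k$. *)

theory Defs
  imports "HOL-Analysis.Analysis"
begin

text \<open>
  Functions into the reals extended by plus infinity are rendered as \<open>ereal\<close>-valued functions;
  properness excludes the value minus infinity.
\<close>

definition eff_dom :: "('a \<Rightarrow> ereal) \<Rightarrow> 'a set" where
  "eff_dom f = {x. f x < \<infinity>}"

definition proper_fun :: "('a \<Rightarrow> ereal) \<Rightarrow> bool" where
  "proper_fun f \<longleftrightarrow> (\<forall>x. f x \<noteq> -\<infinity>) \<and> eff_dom f \<noteq> {}"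

definition minimizers :: "('a \<Rightarrow> ereal) \<Rightarrow> 'a set \<Rightarrow> 'a set" where
  "minimizers f X = {x \<in> X. \<forall>y\<in>X. f x \<le> f y}"

definition min_value :: "('a \<Rightarrow> ereal) \<Rightarrow> 'a set \<Rightarrow> ereal" where
  "min_value f X = (INF x\<in>X. f x)"

definition paraconvex_on ::
    "real \<Rightarrow> real \<Rightarrow> 'a::euclidean_space set \<Rightarrow> ('a \<Rightarrow> ereal) \<Rightarrow> bool" where
  "paraconvex_on \<nu> \<rho> C f \<longleftrightarrow>
     (\<forall>x\<in>C. \<forall>y\<in>C. \<forall>t\<in>{0..1}.
        f (t *\<^sub>R x + (1 - t) *\<^sub>R y)
          \<le> ereal t * f x + ereal (1 - t) * f y
             + ereal (\<rho> * min t (1 - t) * norm (x - y) powr (1 + \<nu>)))"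

text \<open>
  Clarke's generalized directional derivative: the upper limit, as \<open>y\<close> tends to \<open>x\<close> (with
  \<open>y = x\<close> allowed) and \<open>t\<close> tends to 0 from the right, of the difference quotients. The notion is
  meant for points in a neighbourhood of which \<open>f\<close> is finite and Lipschitz; elsewhere the
  difference of two infinite values is a library convention without mathematical content.
\<close>

definition clarke_dderiv :: "('a::euclidean_space \<Rightarrow> ereal) \<Rightarrow> 'a \<Rightarrow> 'a \<Rightarrow> ereal" where
  "clarke_dderiv f x v =
     Limsup (nhds x \<times>\<^sub>F at_right 0) (\<lambda>(y, t). (f (y + t *\<^sub>R v) - f y) / ereal t)"

definition clarke_subdiff :: "('a::euclidean_space \<Rightarrow> ereal) \<Rightarrow> 'a \<Rightarrow> 'a set" where
  "clarke_subdiff f x = {\<zeta>. \<forall>v. ereal (\<zeta> \<bullet> v) \<le> clarke_dderiv f x v}"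

definition holder_error_bound ::
    "real \<Rightarrow> real \<Rightarrow> ('a::euclidean_space \<Rightarrow> ereal) \<Rightarrow> 'a set \<Rightarrow> bool" where
  "holder_error_bound \<mu> \<delta> f X \<longleftrightarrow>
     (\<forall>x\<in>X. ereal (\<mu> * infdist x (minimizers f X) powr (1 / \<delta>)) \<le> f x - min_value f X)"

definition tube ::
    "real \<Rightarrow> real \<Rightarrow> real \<Rightarrow> real \<Rightarrow> ('a::euclidean_space \<Rightarrow> ereal) \<Rightarrow> 'a set \<Rightarrow> real \<Rightarrow> 'a set" where
  "tube \<nu> \<rho> \<delta> \<mu> f X \<gamma> =
     {x \<in> X. infdist x (minimizers f X) < (\<gamma> * \<mu> / \<rho>) powr (\<delta> / (\<delta> * (1 + \<nu>) - 1))}"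

text \<open>Sequences start at index 1; the value at index 0 is irrelevant throughout.\<close>

definition nonsummable_diminishing :: "(nat \<Rightarrow> real) \<Rightarrow> bool" where
  "nonsummable_diminishing \<alpha> \<longleftrightarrow>
     (\<forall>k\<ge>1. 0 \<le> \<alpha> k) \<and> \<alpha> \<longlonglongrightarrow> 0 \<and>
     filterlim (\<lambda>n. \<Sum>k=1..n. \<alpha> k) at_top sequentially"

definition projected_subgradient_seq ::
    "('a::euclidean_space \<Rightarrow> ereal) \<Rightarrow> 'a set \<Rightarrow> (nat \<Rightarrow> real) \<Rightarrow> (nat \<Rightarrow> 'a) \<Rightarrow> bool" where
  "projected_subgradient_seq f X \<alpha> x \<longleftrightarrow>
     (\<forall>k\<ge>1. \<exists>\<zeta> \<in> clarke_subdiff f (x k).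
        x (Suc k) = (if \<zeta> = 0 then x k
                     else closest_point X (x k - (\<alpha> k / norm \<zeta>) *\<^sub>R \<zeta>)))"

end

theory Submission imports Defs begin

text \<open>
  Write \<open>d(z)\<close> for the distance from \<open>z\<close> to the set of minimizers and \<open>h(z) = f z - f*\<close>.
  Paraconvexity is convexity up to an error of order \<open>1 + \<nu>\<close>, so a Clarke subgradient satisfies
  the convex subgradient inequality with the loss \<open>\<rho> * norm (y - x) powr (1 + \<nu>)\<close>
  (\<open>paraconvex_clarke_subgradient_inequality\<close>). Apply it at \<open>z\<close> towards a nearest minimizer \<open>p\<close>:
  the inner product of the subgradient with \<open>z - p\<close> is at least \<open>h(z) - \<rho> * d(z) powr (1 + \<nu>)\<close>.
  Since \<open>1 + \<nu> > 1 / \<delta>\<close>, the loss is of higher order than the lower bound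
  \<open>\<mu> * d(z) powr (1 / \<delta>)\<close> of \<open>h(z)\<close>, and in the tube with \<open>\<gamma> = 1 / 2\<close> it costs at most half of
  \<open>h(z)\<close> (\<open>half_tube_subgradient_points_away\<close>). Inside this tube the method thus behaves as for a
  convex function:
  a step of length \<open>a\<close> changes the squared distance by at most \<open>a\<^sup>2 - a * h(z) / L\<close>
  (\<open>half_tube_step\<close>). A zero subgradient occurs there only at minimizers, where the method pauses.

  The iterates never leave the tube (\<open>half_tube_step_stays\<close>). By the error bound a step leads to
  squared distance at most \<open>d\<^sup>2 - a * (\<mu> / L) * d powr (1 / \<delta>) + a\<^sup>2\<close>. As a function of
  \<open>u = d powr (1 / \<delta>)\<close> this is convex, because \<open>2 * \<delta> \<ge> 1\<close>; so it suffices to compare it with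
  the squared radius at \<open>d = 0\<close> and at \<open>d\<close> equal to the radius. The upper bound imposed on the
  step sizes is what makes both end points work.

  If \<open>h\<close> stayed above some \<open>e > 0\<close> from some index on, then, since \<open>\<alpha> k\<close> tends to 0, the squared
  distance would eventually drop by at least a fixed multiple of \<open>\<alpha> k\<close> at each step, and the
  divergence of the sum of the \<open>\<alpha> k\<close> would make it negative
  (\<open>nonsummable_steps_no_uniform_decrease\<close>). Hence \<open>h\<close> is arbitrarily small at arbitrarily late
  iterates; by the error bound so is \<open>d\<close>, and the limit statements follow. For the
  last one, the set of minimizers is closed because \<open>f\<close> is continuous on the open set \<open>X'\<close>.
\<close>

section \<open>Paraconvex functions and their Clarke subgradients\<close>

text \<open>
  The real-valued counterpart of \<open>paraconvex_on\<close>, which allows ordinary real arithmetic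
  on a convex set where the extended-valued function is finite.
\<close>

definition paraconvex_real_on ::
    "real \<Rightarrow> real \<Rightarrow> 'a::euclidean_space set \<Rightarrow> ('a \<Rightarrow> real) \<Rightarrow> bool" where
  "paraconvex_real_on \<nu> \<rho> C g \<longleftrightarrow>
     (\<forall>x\<in>C. \<forall>y\<in>C. \<forall>t\<in>{0..1}.
        g (t *\<^sub>R x + (1 - t) *\<^sub>R y)
          \<le> t * g x + (1 - t) * g y + \<rho> * min t (1 - t) * norm (x - y) powr (1 + \<nu>))"

lemma paraconvex_real_onD:
  assumes "paraconvex_real_on \<nu> \<rho> C g" "x \<in> C" "y \<in> C" "0 \<le> t" "t \<le> 1"
  shows "g (t *\<^sub>R x + (1 - t) *\<^sub>R y)
    \<le> t * g x + (1 - t) * g y + \<rho> * min t (1 - t) * norm (x - y) powr (1 + \<nu>)"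
  using assms unfolding paraconvex_real_on_def by auto

lemma paraconvex_on_imp_real:
  assumes "paraconvex_on \<nu> \<rho> C f" "convex C" and fin: "\<And>z. z \<in> C \<Longrightarrow> f z = ereal (g z)"
  shows "paraconvex_real_on \<nu> \<rho> C g"
  unfolding paraconvex_real_on_def
proof (intro ballI)
  fix x y t assume xy: "x \<in> C" "y \<in> C" and t: "t \<in> {0..1::real}"
  have z: "t *\<^sub>R x + (1 - t) *\<^sub>R y \<in> C"
    using \<open>convex C\<close> xy t by (auto intro!: convexD)
  have "f (t *\<^sub>R x + (1 - t) *\<^sub>R y) \<le> ereal t * f x + ereal (1 - t) * f y
             + ereal (\<rho> * min t (1 - t) * norm (x - y) powr (1 + \<nu>))"
    using assms(1) xy t unfolding paraconvex_on_def by blast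
  then show "g (t *\<^sub>R x + (1 - t) *\<^sub>R y)
          \<le> t * g x + (1 - t) * g y + \<rho> * min t (1 - t) * norm (x - y) powr (1 + \<nu>)"
    using fin[OF z] fin[OF xy(1)] fin[OF xy(2)] by simp
qed

text \<open>
  The vertices are added one at a time. A point of the new hull lies on a segment from the new
  vertex to the old hull, and paraconvexity along this segment adds only a constant to the larger
  of the two bounds, since the segment is no longer than the diameter of the hull.
\<close>

lemma paraconvex_bounded_above_on_polytope:
  fixes g :: "'a::euclidean_space \<Rightarrow> real"
  assumes pc: "paraconvex_real_on \<nu> \<rho> C g" and "convex C" and "0 \<le> \<rho>" "0 \<le> \<nu>"
    and "finite S" "S \<subseteq> C"
  shows "\<exists>M. \<forall>z \<in> convex hull S. g z \<le> M"
  using \<open>finite S\<close> \<open>S \<subseteq> C\<close>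
proof (induction S rule: finite_induct)
  case empty
  then show ?case by simp
next
  case (insert a S)
  show ?case
  proof (cases "S = {}")
    case True
    then show ?thesis by auto
  next
    case False
    from insert obtain M where M: "\<And>z. z \<in> convex hull S \<Longrightarrow> g z \<le> M" by auto
    have hull_sub: "convex hull S \<subseteq> C"
      using insert.prems \<open>convex C\<close> by (simp add: hull_minimal)
    have "bounded (convex hull S)"
      using insert.hyps finite_imp_bounded bounded_convex_hull by blast
    then obtain B where B: "\<And>z. z \<in> convex hull S \<Longrightarrow> norm z \<le> B"
      unfolding bounded_iff by blast
    define D where "D = norm a + B"
    have D: "norm (a - b) \<le> D" if "b \<in> convex hull S" for b
      using B[OF that] norm_triangle_ineq4[of a b] by (simp add: D_def)
    have "g z \<le> max (g a) M + \<rho> * D powr (1 + \<nu>)" if z: "z \<in> convex hull (insert a S)" for z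
    proof -
      from z obtain u b where u: "0 \<le> u" "u \<le> 1" and b: "b \<in> convex hull S"
        and z_eq: "z = u *\<^sub>R a + (1 - u) *\<^sub>R b"
        unfolding convex_hull_insert[OF False] by (auto simp: add_eq_0_iff)
      have "g z \<le> u * g a + (1 - u) * g b + \<rho> * min u (1 - u) * norm (a - b) powr (1 + \<nu>)"
        unfolding z_eq using u b hull_sub insert.prems by (intro paraconvex_real_onD[OF pc]) auto
      moreover have "u * g a \<le> u * max (g a) M"
        using u by (intro mult_left_mono) auto
      moreover have "(1 - u) * g b \<le> (1 - u) * max (g a) M"
        using u M[OF b] by (intro mult_left_mono) auto
      moreover have "\<rho> * min u (1 - u) * norm (a - b) powr (1 + \<nu>) \<le> \<rho> * 1 * D powr (1 + \<nu>)"
        using u D[OF b] \<open>0 \<le> \<rho>\<close> \<open>0 \<le> \<nu>\<close> by (intro mult_mono powr_mono2 mult_left_mono) auto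
      ultimately show ?thesis by (simp add: algebra_simps)
    qed
    then show ?thesis by blast
  qed
qed

text \<open>
  A small box around a point is the convex hull of its finitely many corners.
\<close>

lemma paraconvex_locally_bounded_above:
  fixes g :: "'a::euclidean_space \<Rightarrow> real"
  assumes pc: "paraconvex_real_on \<nu> \<rho> C g" and "open C" "convex C" and "0 \<le> \<rho>" "0 \<le> \<nu>"
    and "x \<in> C"
  obtains r M where "0 < r" "cball x r \<subseteq> C" "\<And>z. z \<in> cball x r \<Longrightarrow> g z \<le> M"
proof -
  obtain a b where ab: "x \<in> box a b" "cbox a b \<subseteq> C"
    using \<open>open C\<close> \<open>x \<in> C\<close> by (metis open_contains_cbox)
  have "polytope (cbox a b)"
    by (rule polytope_interval)
  then obtain S where S: "finite S" "cbox a b = convex hull S"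
    unfolding polytope_def by blast
  have "S \<subseteq> C"
    using S(2) ab(2) hull_subset[of S convex] by auto
  then obtain M where M: "\<And>z. z \<in> cbox a b \<Longrightarrow> g z \<le> M"
    using paraconvex_bounded_above_on_polytope[OF pc \<open>convex C\<close> \<open>0 \<le> \<rho>\<close> \<open>0 \<le> \<nu>\<close> S(1)] S(2)
    by blast
  obtain r where "0 < r" "cball x r \<subseteq> box a b"
    using ab(1) open_box[of a b] open_contains_cball[of "box a b"] by auto
  with ab(2) M box_subset_cbox[of a b] show ?thesis
    by (intro that[of r M]) blast+
qed

text \<open>
  The classical argument that a convex function bounded above near \<open>x\<close> is continuous at \<open>x\<close>
  survives the paraconvex error. Put \<open>y = x + t u\<close> with \<open>norm u = r\<close>. Then \<open>y\<close> lies between \<open>x\<close>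
  and \<open>x + u\<close>, which bounds \<open>g y - g x\<close> above, and \<open>x\<close> lies between \<open>x - u\<close> and \<open>y\<close>, which bounds
  \<open>g x - g y\<close> above. Both bounds are multiples of \<open>t\<close>, because the factor \<open>min t (1 - t)\<close>
  in the error term is at most \<open>t\<close>.
\<close>

lemma paraconvex_isCont:
  fixes g :: "'a::euclidean_space \<Rightarrow> real"
  assumes pc: "paraconvex_real_on \<nu> \<rho> C g" and "open C" "convex C" and "0 \<le> \<rho>" "0 \<le> \<nu>"
    and "x \<in> C"
  shows "isCont g x"
proof -
  obtain r M where r: "0 < r" "cball x r \<subseteq> C" and M: "\<And>z. z \<in> cball x r \<Longrightarrow> g z \<le> M"
    using paraconvex_locally_bounded_above[OF assms] by metis
  define K where "K = M - g x + \<rho> * (2 * r) powr (1 + \<nu>)"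
  have bound: "\<bar>g y - g x\<bar> \<le> K / r * norm (y - x)" if y: "y \<in> cball x r" for y
  proof (cases "y = x")
    case False
    define t where "t = norm (y - x) / r"
    have t: "0 < t" "t \<le> 1"
      using False y r by (auto simp: t_def dist_norm norm_minus_commute)
    define u where "u = (1 / t) *\<^sub>R (y - x)"
    have norm_u: "norm u = r"
      using t False r by (simp add: u_def t_def)
    have y_eq: "y = x + t *\<^sub>R u"
      using t by (simp add: u_def)
    have in_ball: "x + u \<in> cball x r" "x - u \<in> cball x r" "x \<in> cball x r"
      using norm_u r by (auto simp: dist_norm)
    have in_C: "x + u \<in> C" "x - u \<in> C" "x \<in> C" "y \<in> C"
      using in_ball y r by auto
    have powr_le: "r powr (1 + \<nu>) \<le> (2 * r) powr (1 + \<nu>)"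
      using r \<open>0 \<le> \<nu>\<close> by (intro powr_mono2) auto
    have upper: "g y - g x \<le> t * K"
    proof -
      have "g y = g (t *\<^sub>R (x + u) + (1 - t) *\<^sub>R x)"
        by (simp add: y_eq algebra_simps)
      also have "\<dots> \<le> t * g (x + u) + (1 - t) * g x
          + \<rho> * min t (1 - t) * norm ((x + u) - x) powr (1 + \<nu>)"
        using pc in_C t by (intro paraconvex_real_onD) auto
      also have "\<rho> * min t (1 - t) * norm ((x + u) - x) powr (1 + \<nu>)
          \<le> \<rho> * t * (2 * r) powr (1 + \<nu>)"
        using powr_le t \<open>0 \<le> \<rho>\<close> by (intro mult_mono mult_left_mono) (auto simp: norm_u)
      also have "t * g (x + u) \<le> t * M"
        using M in_ball t by (intro mult_left_mono) auto
      finally show ?thesis by (simp add: K_def algebra_simps)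
    qed
    have lower: "g x - g y \<le> t * K"
    proof -
      define s where "s = t / (1 + t)"
      have s: "0 \<le> s" "s \<le> 1" "1 - s = 1 / (1 + t)"
        using t by (auto simp: s_def field_simps)
      have "s *\<^sub>R (x - u) + (1 - s) *\<^sub>R y = x + ((1 - s) * t - s) *\<^sub>R u"
        by (simp add: y_eq algebra_simps)
      also have "(1 - s) * t - s = 0"
        using s(3) by (simp add: s_def)
      finally have x_eq: "x = s *\<^sub>R (x - u) + (1 - s) *\<^sub>R y" by simp
      have "(x - u) - y = - ((1 + t) *\<^sub>R u)"
        by (simp add: y_eq algebra_simps)
      then have "norm ((x - u) - y) = (1 + t) * r"
        using norm_u t by simp
      then have dist_le: "norm ((x - u) - y) \<le> 2 * r"
        using t r by simp
      have "g x \<le> s * g (x - u) + (1 - s) * g y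
          + \<rho> * min s (1 - s) * norm ((x - u) - y) powr (1 + \<nu>)"
        using paraconvex_real_onD[OF pc in_C(2,4) s(1,2)] x_eq by simp
      also have "\<rho> * min s (1 - s) * norm ((x - u) - y) powr (1 + \<nu>)
          \<le> \<rho> * s * (2 * r) powr (1 + \<nu>)"
        using dist_le s \<open>0 \<le> \<rho>\<close> \<open>0 \<le> \<nu>\<close> by (intro mult_mono mult_left_mono powr_mono2) auto
      also have "s * g (x - u) \<le> s * M"
        using M in_ball s by (intro mult_left_mono) auto
      finally have "g x \<le> s * (M + \<rho> * (2 * r) powr (1 + \<nu>)) + (1 - s) * g y"
        by (simp add: algebra_simps)
      also have "\<dots> = (t * (M + \<rho> * (2 * r) powr (1 + \<nu>)) + g y) / (1 + t)"
        unfolding s(3) by (simp add: s_def add_divide_distrib)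
      finally have "g x * (1 + t) \<le> t * (M + \<rho> * (2 * r) powr (1 + \<nu>)) + g y"
        using t by (simp add: pos_le_divide_eq)
      then show ?thesis by (simp add: K_def algebra_simps)
    qed
    have "K / r * norm (y - x) = t * K" by (simp add: t_def)
    with upper lower show ?thesis by linarith
  qed auto
  have "((\<lambda>y. K / r * norm (y - x)) \<longlongrightarrow> K / r * norm (x - x)) (at x)"
    by (intro tendsto_intros)
  then have lim: "((\<lambda>y. K / r * norm (y - x)) \<longlongrightarrow> 0) (at x)" by simp
  have "\<forall>\<^sub>F y in at x. y \<in> cball x r"
    using r(1) by (auto simp: eventually_at dist_commute intro!: exI[of _ r])
  then have "\<forall>\<^sub>F y in at x. norm (g y - g x) \<le> K / r * norm (y - x)"
    by eventually_elim (use bound in auto)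
  then have "((\<lambda>y. g y - g x) \<longlongrightarrow> 0) (at x)"
    using lim by (rule Lim_null_comparison)
  then show ?thesis
    using LIM_zero_cancel isCont_def by blast
qed

text \<open>
  For \<open>0 < t < 1\<close> the point \<open>z + t v\<close> is a convex combination of \<open>z + v\<close> and \<open>z\<close>, so paraconvexity
  bounds the difference quotient at \<open>z\<close> in the direction \<open>v = y - x\<close> by
  \<open>g (z + v) - g z + \<rho> * norm v powr (1 + \<nu>)\<close>, uniformly in \<open>t\<close>. Continuity of \<open>g\<close> at \<open>x\<close> and at \<open>y\<close>
  carries this bound to the upper limit as \<open>z\<close> tends to \<open>x\<close>.
\<close>

lemma paraconvex_clarke_subgradient_inequality:
  fixes f :: "'a::euclidean_space \<Rightarrow> ereal"
  assumes pc: "paraconvex_real_on \<nu> \<rho> C g" and "open C" "convex C" and "0 \<le> \<rho>" "0 \<le> \<nu>"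
    and fin: "\<And>z. z \<in> C \<Longrightarrow> f z = ereal (g z)"
    and "x \<in> C" "y \<in> C" and \<zeta>: "\<zeta> \<in> clarke_subdiff f x"
  shows "g x + \<zeta> \<bullet> (y - x) - \<rho> * norm (y - x) powr (1 + \<nu>) \<le> g y"
proof -
  define v where "v = y - x"
  have cont: "isCont g x" "isCont g y"
    using paraconvex_isCont[OF pc \<open>open C\<close> \<open>convex C\<close> \<open>0 \<le> \<rho>\<close> \<open>0 \<le> \<nu>\<close>] \<open>x \<in> C\<close> \<open>y \<in> C\<close> by auto
  have shift: "((\<lambda>z. z + v) \<longlongrightarrow> y) (nhds x)"
  proof -
    have "((\<lambda>z. z + v) \<longlongrightarrow> x + v) (nhds x)"
      by (intro tendsto_intros filterlim_ident)
    then show ?thesis by (simp add: v_def)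
  qed
  have lim: "((\<lambda>z. g (z + v) - g z) \<longlongrightarrow> g y - g x) (nhds x)"
    by (intro tendsto_diff isCont_tendsto_compose[OF cont(2) shift]
        isCont_tendsto_compose[OF cont(1) filterlim_ident])
  have "\<zeta> \<bullet> v \<le> g y - g x + \<rho> * norm v powr (1 + \<nu>) + e" if "0 < e" for e
  proof -
    have near: "\<forall>\<^sub>F z in nhds x. z \<in> C \<and> z + v \<in> C \<and> g (z + v) - g z < g y - g x + e"
      using eventually_nhds_in_open[OF \<open>open C\<close> \<open>x \<in> C\<close>]
        topological_tendstoD[OF shift \<open>open C\<close> \<open>y \<in> C\<close>]
        order_tendstoD(2)[OF lim, of "g y - g x + e"] that
      by (auto simp: eventually_conj_iff)
    have small: "\<forall>\<^sub>F t in at_right 0. 0 < t \<and> t < (1::real)"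
      by (auto simp: eventually_at_right[of 0 1] intro!: exI[of _ 1])
    have quotient: "(f (z + t *\<^sub>R v) - f z) / ereal t
        \<le> ereal (g y - g x + e + \<rho> * norm v powr (1 + \<nu>))"
      if z: "z \<in> C" "z + v \<in> C" and less: "g (z + v) - g z < g y - g x + e"
        and t: "0 < t" "t < 1" for z t
    proof -
      have comb: "z + t *\<^sub>R v = t *\<^sub>R (z + v) + (1 - t) *\<^sub>R z"
        by (simp add: algebra_simps)
      have mem: "z + t *\<^sub>R v \<in> C"
        unfolding comb using \<open>convex C\<close> z t by (intro convexD) auto
      have "g (z + t *\<^sub>R v) \<le> t * g (z + v) + (1 - t) * g z
          + \<rho> * min t (1 - t) * norm ((z + v) - z) powr (1 + \<nu>)"
        unfolding comb using pc z t by (intro paraconvex_real_onD) auto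
      also have "\<rho> * min t (1 - t) * norm ((z + v) - z) powr (1 + \<nu>)
          \<le> \<rho> * t * norm v powr (1 + \<nu>)"
        using \<open>0 \<le> \<rho>\<close> t by (auto intro!: mult_right_mono mult_left_mono)
      finally have "g (z + t *\<^sub>R v) - g z \<le> t * (g (z + v) - g z + \<rho> * norm v powr (1 + \<nu>))"
        by (simp add: algebra_simps)
      also have "\<dots> \<le> t * (g y - g x + e + \<rho> * norm v powr (1 + \<nu>))"
        using less t by (intro mult_left_mono) auto
      finally show ?thesis
        using t by (simp add: fin[OF z(1)] fin[OF mem] pos_divide_le_eq mult.commute)
    qed
    have "\<forall>\<^sub>F p in nhds x \<times>\<^sub>F at_right 0. case p of (z, t) \<Rightarrow>
        (f (z + t *\<^sub>R v) - f z) / ereal t \<le> ereal (g y - g x + e + \<rho> * norm v powr (1 + \<nu>))"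
      using eventually_prodI[OF near small] by (rule eventually_mono) (use quotient in auto)
    then have "clarke_dderiv f x v \<le> ereal (g y - g x + e + \<rho> * norm v powr (1 + \<nu>))"
      unfolding clarke_dderiv_def by (intro Limsup_bounded) (simp add: case_prod_unfold)
    moreover have "ereal (\<zeta> \<bullet> v) \<le> clarke_dderiv f x v"
      using \<zeta> unfolding clarke_subdiff_def by blast
    ultimately have "ereal (\<zeta> \<bullet> v) \<le> ereal (g y - g x + e + \<rho> * norm v powr (1 + \<nu>))"
      by (rule order_trans[rotated])
    then show ?thesis by simp
  qed
  then have "\<zeta> \<bullet> v \<le> g y - g x + \<rho> * norm v powr (1 + \<nu>)"
    by (rule field_le_epsilon)
  then show ?thesis by (simp add: v_def)
qed

section \<open>Estimates for one step and for the step sizes\<close>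

text \<open>
  The projection is nonexpansive and fixes \<open>p\<close>, so the distance to \<open>p\<close> can only shrink when the
  unprojected step is projected; then the square is expanded.
\<close>

lemma projected_step_distance:
  fixes X :: "'a::euclidean_space set"
  assumes "closed X" "convex X" "p \<in> X" "\<zeta> \<noteq> 0"
  shows "(dist (closest_point X (x - (a / norm \<zeta>) *\<^sub>R \<zeta>)) p)\<^sup>2
    \<le> (dist x p)\<^sup>2 - 2 * (a / norm \<zeta>) * (\<zeta> \<bullet> (x - p)) + a\<^sup>2"
proof -
  define y where "y = x - (a / norm \<zeta>) *\<^sub>R \<zeta>"
  have "dist (closest_point X y) p \<le> dist y p"
    using closest_point_lipschitz[of X y p] assms closest_point_self[of p X] by auto
  then have "(dist (closest_point X y) p)\<^sup>2 \<le> (dist y p)\<^sup>2"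
    by (intro power_mono) auto
  also have "dist y p = norm ((x - p) - (a / norm \<zeta>) *\<^sub>R \<zeta>)"
    by (simp add: y_def dist_norm algebra_simps)
  also have "(norm ((x - p) - (a / norm \<zeta>) *\<^sub>R \<zeta>))\<^sup>2
      = (norm (x - p))\<^sup>2 - 2 * (a / norm \<zeta>) * (\<zeta> \<bullet> (x - p)) + (norm ((a / norm \<zeta>) *\<^sub>R \<zeta>))\<^sup>2"
    unfolding power2_norm_eq_inner by (simp add: inner_diff inner_commute)
  also have "norm ((a / norm \<zeta>) *\<^sub>R \<zeta>) = \<bar>a\<bar>"
    using \<open>\<zeta> \<noteq> 0\<close> by simp
  finally show ?thesis by (simp add: y_def dist_norm)
qed

text \<open>
  The exponents differ by \<open>e = 1 + \<nu> - 1 / \<delta> > 0\<close>, and the bound on \<open>d\<close> says precisely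
  that \<open>\<rho> * d powr e < \<mu> / 2\<close>.
\<close>

lemma half_tube_error_absorbed:
  fixes d \<nu> \<rho> \<delta> \<mu> :: real
  assumes "0 < \<rho>" "0 < \<mu>" "0 < \<delta>" "1 < \<delta> * (1 + \<nu>)" "0 \<le> d"
    and d: "d < (\<mu> / (2 * \<rho>)) powr (\<delta> / (\<delta> * (1 + \<nu>) - 1))"
  shows "\<rho> * d powr (1 + \<nu>) \<le> \<mu> / 2 * d powr (1 / \<delta>)"
proof (cases "d = 0")
  case False
  define e where "e = 1 + \<nu> - 1 / \<delta>"
  have e: "e = (\<delta> * (1 + \<nu>) - 1) / \<delta>" "0 < e"
    using assms by (auto simp: e_def field_simps)
  have "d powr e \<le> ((\<mu> / (2 * \<rho>)) powr (1 / e)) powr e"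
    using d e assms by (intro powr_mono2) auto
  also have "\<dots> = \<mu> / (2 * \<rho>)"
    using e assms by (simp add: powr_powr)
  finally have "\<rho> * d powr e \<le> \<mu> / 2"
    using \<open>0 < \<rho>\<close> by (simp add: field_simps)
  then have "\<rho> * d powr e * d powr (1 / \<delta>) \<le> \<mu> / 2 * d powr (1 / \<delta>)"
    by (intro mult_right_mono) auto
  moreover have "d powr (1 + \<nu>) = d powr e * d powr (1 / \<delta>)"
    by (simp add: e_def flip: powr_add)
  ultimately show ?thesis by (simp add: mult.assoc)
qed simp

text \<open>
  The left-hand side is a convex function of \<open>d powr (1 / \<delta>) = l * s\<close> for \<open>l\<close> between 0 and 1,
  because \<open>d\<^sup>2\<close> is then a multiple of \<open>l powr (2 * \<delta>)\<close> with \<open>2 * \<delta> \<ge> 1\<close>. It is therefore below the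
  chord between its values at \<open>l = 0\<close> and \<open>l = 1\<close>. The value \<open>a\<^sup>2\<close> at \<open>l = 0\<close> is small enough
  because \<open>a < min 1 s \<le> s powr \<delta>\<close>, and the value at \<open>l = 1\<close> because \<open>a < m * s\<close>.
\<close>

lemma step_bound_below_radius:
  fixes d s m a \<delta> :: real
  assumes "0 \<le> d" "d < s powr \<delta>" "0 < s" "1 / 2 \<le> \<delta>" "\<delta> \<le> 1"
    and a: "0 < a" "a < 1" "a < s" "a < m * s"
  shows "d\<^sup>2 - a * (m * d powr (1 / \<delta>)) + a\<^sup>2 < (s powr \<delta>)\<^sup>2"
proof -
  define l where "l = d powr (1 / \<delta>) / s"
  have "d powr (1 / \<delta>) \<le> (s powr \<delta>) powr (1 / \<delta>)"
    using assms by (intro powr_mono2) auto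
  also have "\<dots> = s"
    using assms by (simp add: powr_powr)
  finally have l: "0 \<le> l" "l \<le> 1"
    using \<open>0 < s\<close> by (auto simp: l_def)
  have d_powr: "d powr (1 / \<delta>) = l * s"
    using \<open>0 < s\<close> by (simp add: l_def)
  have "d = (l * s) powr \<delta>"
    using assms by (simp add: powr_powr flip: d_powr)
  then have "d = l powr \<delta> * s powr \<delta>"
    using l \<open>0 < s\<close> by (simp add: powr_mult)
  moreover have "(l powr \<delta>)\<^sup>2 \<le> l"
  proof (cases "l = 0")
    case False
    have "(l powr \<delta>)\<^sup>2 = l powr (2 * \<delta>)"
      by (simp add: power2_eq_square flip: powr_add)
    also have "\<dots> \<le> l powr 1"
      using l False assms by (intro powr_mono') auto
    finally show ?thesis using l by simp
  qed simp
  ultimately have d2: "d\<^sup>2 \<le> l * (s powr \<delta>)\<^sup>2"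
    by (simp add: power_mult_distrib mult_right_mono)
  have a_less: "a < s powr \<delta>"
  proof (cases "s \<le> 1")
    case True
    then have "s powr 1 \<le> s powr \<delta>"
      using assms by (intro powr_mono') auto
    then show ?thesis using a \<open>0 < s\<close> by simp
  next
    case False
    then have "1 \<le> s powr \<delta>"
      using assms by (intro ge_one_powr_ge_zero) auto
    then show ?thesis using a by simp
  qed
  then have at_zero: "a\<^sup>2 < (s powr \<delta>)\<^sup>2"
    using a by (intro power_strict_mono) auto
  have at_radius: "(s powr \<delta>)\<^sup>2 - a * (m * s) + a\<^sup>2 < (s powr \<delta>)\<^sup>2"
    using mult_strict_left_mono[OF a(4) a(1)] by (simp add: power2_eq_square)
  have "d\<^sup>2 - a * (m * d powr (1 / \<delta>)) + a\<^sup>2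
      \<le> l * ((s powr \<delta>)\<^sup>2 - a * (m * s) + a\<^sup>2) + (1 - l) * a\<^sup>2"
    using d2 by (simp add: d_powr algebra_simps)
  also have "\<dots> < (s powr \<delta>)\<^sup>2"
    using l at_radius at_zero by (intro convex_bound_lt) auto
  finally show ?thesis .
qed

text \<open>
  Once \<open>\<alpha> k < c / 2\<close>, the quadratic term consumes at most half of the linear decrease.
  Summing the remaining decreases \<open>c / 2 * \<alpha> k\<close> bounds the partial sums of \<open>\<alpha>\<close>, which diverge.
\<close>

lemma nonsummable_steps_no_uniform_decrease:
  fixes D \<alpha> :: "nat \<Rightarrow> real"
  assumes \<alpha>: "nonsummable_diminishing \<alpha>" and "0 < c" and D: "\<And>k. 0 \<le> D k"
    and dec: "\<And>k. k \<ge> K \<Longrightarrow> D (Suc k) \<le> D k - c * \<alpha> k + (\<alpha> k)\<^sup>2"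
  shows False
proof -
  have nonneg: "\<And>k. k \<ge> 1 \<Longrightarrow> 0 \<le> \<alpha> k" and lim: "\<alpha> \<longlonglongrightarrow> 0"
    and div: "filterlim (\<lambda>n. \<Sum>k=1..n. \<alpha> k) at_top sequentially"
    using \<alpha> unfolding nonsummable_diminishing_def by auto
  have "\<forall>\<^sub>F k in sequentially. \<alpha> k < c / 2"
    using order_tendstoD(2)[OF lim, of "c / 2"] \<open>0 < c\<close> by simp
  then obtain N where N: "\<And>k. k \<ge> N \<Longrightarrow> \<alpha> k < c / 2"
    by (auto simp: eventually_sequentially)
  define M where "M = Max {N, K, 1}"
  have M: "N \<le> M" "K \<le> M" "1 \<le> M" by (auto simp: M_def)
  have half: "D (Suc k) \<le> D k - c / 2 * \<alpha> k" if "k \<ge> M" for k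
  proof -
    have "\<alpha> k * \<alpha> k \<le> c / 2 * \<alpha> k"
      using that M N[of k] nonneg[of k] by (intro mult_right_mono) auto
    with dec[of k] that M show ?thesis by (simp add: power2_eq_square)
  qed
  define B where "B = D M + c / 2 * (\<Sum>k=1..M. \<alpha> k)"
  have telescoped: "D (Suc n) + c / 2 * (\<Sum>k=1..n. \<alpha> k) \<le> B" if "n \<ge> M" for n
    using that
  proof (induction n rule: dec_induct)
    case base
    have "0 \<le> c / 2 * \<alpha> M" using nonneg[of M] M \<open>0 < c\<close> by simp
    with half[of M] show ?case by (simp add: B_def)
  next
    case (step n)
    then show ?case using half[of "Suc n"] by (simp add: algebra_simps)
  qed
  have "\<forall>\<^sub>F n in sequentially. 2 * B / c < (\<Sum>k=1..n. \<alpha> k) \<and> M \<le> n"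
    using filterlim_at_top_dense[THEN iffD1, OF div] eventually_ge_at_top[of M]
    by (auto simp: eventually_conj_iff)
  then obtain n where "2 * B / c < (\<Sum>k=1..n. \<alpha> k)" "M \<le> n"
    by (auto simp: eventually_sequentially)
  then have "B < c / 2 * (\<Sum>k=1..n. \<alpha> k)"
    using \<open>0 < c\<close> by (simp add: field_simps)
  with telescoped[OF \<open>M \<le> n\<close>] D[of "Suc n"] show False by simp
qed

section \<open>Limits of sequences that recurrently approach a lower bound\<close>

lemma liminf_eq_attained_bound:
  fixes u :: "nat \<Rightarrow> ereal"
  assumes bound: "\<And>k. k \<ge> 1 \<Longrightarrow> ereal l \<le> u k"
    and near: "\<And>e K. 0 < e \<Longrightarrow> \<exists>k\<ge>K. u k < ereal (l + e)"
  shows "liminf u = ereal l"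
proof (rule antisym)
  show "liminf u \<le> ereal l"
  proof (rule ccontr)
    assume "\<not> liminf u \<le> ereal l"
    then obtain c where c: "ereal l < ereal c" "ereal c < liminf u"
      using ereal_dense2[of "ereal l" "liminf u"] by (auto simp: not_le)
    then obtain K where K: "\<And>k. k \<ge> K \<Longrightarrow> ereal c < u k"
      using less_LiminfD[OF c(2)] by (auto simp: eventually_sequentially)
    obtain k where "k \<ge> K" "u k < ereal (l + (c - l))"
      using near[of "c - l" K] c(1) by auto
    with K[of k] show False by simp
  qed
  show "ereal l \<le> liminf u"
    using bound by (intro Liminf_bounded) (auto simp: eventually_sequentially)
qed

lemma running_min_tendsto:
  fixes u :: "nat \<Rightarrow> ereal"
  assumes bound: "\<And>k. k \<ge> 1 \<Longrightarrow> ereal l \<le> u k"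
    and near: "\<And>e K. 0 < e \<Longrightarrow> \<exists>k\<ge>K. u k < ereal (l + e)"
  shows "(\<lambda>k. Min (u ` {1..k})) \<longlonglongrightarrow> ereal l"
proof (rule order_tendstoI)
  fix a assume "a < ereal l"
  then have "a < Min (u ` {1..k})" if "k \<ge> 1" for k
    using that bound by (auto simp: Min_gr_iff intro: less_le_trans)
  then show "\<forall>\<^sub>F k in sequentially. a < Min (u ` {1..k})"
    unfolding eventually_sequentially by blast
next
  fix a assume "ereal l < a"
  then obtain c where c: "ereal l < ereal c" "ereal c < a"
    using ereal_dense2 by blast
  then obtain j where j: "j \<ge> 1" "u j < ereal (l + (c - l))"
    using near[of "c - l" 1] by auto
  have "Min (u ` {1..k}) < a" if "k \<ge> j" for k
  proof -
    have "Min (u ` {1..k}) \<le> u j"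
      using that j by (intro Min_le) auto
    also have "\<dots> < a"
      using j(2) c(2) by simp
    finally show ?thesis .
  qed
  then show "\<forall>\<^sub>F k in sequentially. Min (u ` {1..k}) < a"
    unfolding eventually_sequentially by blast
qed

text \<open>
  A subsequence realizes the lower limit of the distances, and compactness extracts from it a
  convergent one; its limit has distance 0 to the closed set.
\<close>

lemma bounded_subsequence_to_closed_set:
  fixes x :: "nat \<Rightarrow> 'a::heine_borel"
  assumes "closed S" "S \<noteq> {}" and bdd: "bounded (x ` {1..})"
    and liminf: "liminf (\<lambda>k. ereal (infdist (x k) S)) = 0"
  shows "\<exists>l\<in>S. \<exists>r. strict_mono r \<and> r 0 \<ge> 1 \<and> (x \<circ> r) \<longlonglongrightarrow> l"
proof -
  obtain q where q: "strict_mono q" "((\<lambda>k. ereal (infdist (x k) S)) \<circ> q) \<longlonglongrightarrow> 0"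
    using liminf_subseq_lim[of "\<lambda>k. ereal (infdist (x k) S)"] liminf by auto
  \<comment> \<open>The shift excludes the index 0, which the boundedness assumption does not cover.\<close>
  define y where "y n = x (q (Suc n))" for n
  have q_ge: "q (Suc n) \<ge> 1" for n
    using seq_suble[OF q(1), of "Suc n"] by simp
  have "bounded (range y)"
    using bdd by (rule bounded_subset) (use q_ge in \<open>auto simp: y_def\<close>)
  then obtain l s where s: "strict_mono s" "(y \<circ> s) \<longlonglongrightarrow> l"
    using bounded_imp_convergent_subsequence by blast
  have "(\<lambda>n. ereal (infdist (x (q n)) S)) \<longlonglongrightarrow> ereal 0"
    using q(2) by (simp add: o_def zero_ereal_def)
  then have "(\<lambda>n. infdist (x (q n)) S) \<longlonglongrightarrow> 0"
    by simp
  then have "(\<lambda>n. infdist (y n) S) \<longlonglongrightarrow> 0"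
    unfolding y_def by (rule LIMSEQ_Suc)
  from LIMSEQ_subseq_LIMSEQ[OF this s(1)] have "(\<lambda>n. infdist ((y \<circ> s) n) S) \<longlonglongrightarrow> 0"
    by (simp add: o_def)
  moreover have "(\<lambda>n. infdist ((y \<circ> s) n) S) \<longlonglongrightarrow> infdist l S"
    using s(2) by (rule tendsto_infdist)
  ultimately have "infdist l S = 0"
    using LIMSEQ_unique by blast
  then have "l \<in> S"
    using in_closed_iff_infdist_zero[OF assms(1,2)] by simp
  moreover have "strict_mono (\<lambda>n. q (Suc (s n)))"
    using q(1) s(1) by (auto simp: strict_mono_def)
  moreover have "(x \<circ> (\<lambda>n. q (Suc (s n)))) \<longlonglongrightarrow> l"
    using s(2) by (simp add: o_def y_def)
  ultimately show ?thesis using q_ge by blast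
qed

section \<open>The subgradient step near the minimizers\<close>

locale paraconvex_error_bound =
  fixes f :: "'a::euclidean_space \<Rightarrow> ereal" and X X' :: "'a set" and \<rho> \<nu> \<delta> \<mu> :: real
  assumes proper: "proper_fun f"
    and X: "closed X" "convex X" "X \<subseteq> X'"
    and minimizers_nonempty: "minimizers f X \<noteq> {}"
    and params: "0 < \<rho>" "0 < \<nu>" "\<nu> \<le> 1" "1 / (1 + \<nu>) < \<delta>" "\<delta> \<le> 1" "0 < \<mu>"
    and X': "open X'" "convex X'" "X' \<subseteq> eff_dom f"
    and paraconvex: "paraconvex_on \<nu> \<rho> X' f"
    and error_bound: "holder_error_bound \<mu> \<delta> f X"
begin

text \<open>
  The finite values of \<open>f\<close>; the value of \<open>g\<close> outside \<open>X'\<close> carries no information.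
\<close>

definition g :: "'a \<Rightarrow> real" where
  "g z = real_of_ereal (f z)"

definition fstar :: real where
  "fstar = real_of_ereal (min_value f X)"

abbreviation Xstar :: "'a set" where
  "Xstar \<equiv> minimizers f X"

abbreviation half_tube :: "'a set" where
  "half_tube \<equiv> tube \<nu> \<rho> \<delta> \<mu> f X (1 / 2)"

lemma \<delta>_bounds: "1 / 2 \<le> \<delta>" "0 < \<delta>" "1 < \<delta> * (1 + \<nu>)"
proof -
  have "1 / 2 \<le> 1 / (1 + \<nu>)"
    using params by (simp add: field_simps)
  then show "1 / 2 \<le> \<delta>" "0 < \<delta>" using params by linarith+
  show "1 < \<delta> * (1 + \<nu>)"
    using params by (simp add: field_simps)
qed

lemma f_eq_g: "f z = ereal (g z)" if "z \<in> X'"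
proof -
  have "f z \<noteq> -\<infinity>" "f z \<noteq> \<infinity>"
    using that proper X' by (auto simp: proper_fun_def eff_dom_def)
  then show ?thesis by (cases "f z") (auto simp: g_def)
qed

lemma paraconvex_g: "paraconvex_real_on \<nu> \<rho> X' g"
  using paraconvex X'(2) f_eq_g by (rule paraconvex_on_imp_real)

lemma min_value_eq_f: "min_value f X = f p" if "p \<in> Xstar"
  unfolding min_value_def
  using that by (intro antisym INF_lower INF_greatest) (auto simp: minimizers_def)

lemma g_minimizer: "g p = fstar" if "p \<in> Xstar"
  using min_value_eq_f[OF that] by (simp add: g_def fstar_def)

lemma min_value_eq: "min_value f X = ereal fstar"
proof -
  obtain p where p: "p \<in> Xstar" using minimizers_nonempty by blast
  then have "p \<in> X'" using X(3) by (auto simp: minimizers_def)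
  then show ?thesis using min_value_eq_f[OF p] f_eq_g g_minimizer[OF p] by simp
qed

lemma fstar_le: "fstar \<le> g z" if "z \<in> X"
proof -
  have "min_value f X \<le> f z"
    unfolding min_value_def using that by (rule INF_lower)
  then show ?thesis using that X(3) f_eq_g[of z] by (auto simp: min_value_eq)
qed

lemma minimizers_eq: "Xstar = {z \<in> X. g z \<le> fstar}"
proof
  show "Xstar \<subseteq> {z \<in> X. g z \<le> fstar}"
    using g_minimizer by (auto simp: minimizers_def)
  show "{z \<in> X. g z \<le> fstar} \<subseteq> Xstar"
  proof clarify
    fix z assume z: "z \<in> X" "g z \<le> fstar"
    have "f z \<le> f y" if "y \<in> X" for y
      using z that fstar_le[OF that] f_eq_g X(3) by (auto simp: subset_iff)
    then show "z \<in> Xstar" using z by (simp add: minimizers_def)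
  qed
qed

text \<open>
  Paraconvexity makes \<open>f\<close> continuous on \<open>X'\<close>, so the minimizers form a sublevel set of a continuous
  function on the closed set \<open>X\<close>. As they need not form a convex set, closedness is what
  guarantees a nearest minimizer.
\<close>

lemma closed_minimizers: "closed Xstar"
proof -
  have "isCont g z" if "z \<in> X'" for z
    using paraconvex_isCont[OF paraconvex_g X'(1,2) _ _ that] params by simp
  then have "continuous_on X g"
    using X(3) by (auto intro!: continuous_at_imp_continuous_on)
  then have "closed (X \<inter> g -` {..fstar})"
    using X(1) by (intro continuous_closed_preimage) auto
  also have "X \<inter> g -` {..fstar} = Xstar"
    by (auto simp: minimizers_eq)
  finally show ?thesis .
qed

lemma error_bound_g: "\<mu> * infdist z Xstar powr (1 / \<delta>) \<le> g z - fstar" if "z \<in> X"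
proof -
  have "f z = ereal (g z)" using that X(3) f_eq_g by blast
  then show ?thesis
    using error_bound that by (auto simp: holder_error_bound_def min_value_eq)
qed

lemma half_tube_iff:
  "z \<in> half_tube \<longleftrightarrow>
    z \<in> X \<and> infdist z Xstar < (\<mu> / (2 * \<rho>)) powr (\<delta> / (\<delta> * (1 + \<nu>) - 1))"
  by (simp add: tube_def)

text \<open>
  The larger tube is the one over which \<open>L\<close> bounds the subgradients, so this inclusion makes the
  bound available along the iteration.
\<close>

lemma half_tube_subset: "half_tube \<subseteq> tube \<nu> \<rho> \<delta> \<mu> f X 1"
proof -
  have "(\<mu> / (2 * \<rho>)) powr (\<delta> / (\<delta> * (1 + \<nu>) - 1)) \<le> (\<mu> / \<rho>) powr (\<delta> / (\<delta> * (1 + \<nu>) - 1))"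
    using params \<delta>_bounds by (intro powr_mono2) (auto simp: field_simps)
  then show ?thesis by (auto simp: half_tube_iff) (simp add: tube_def)
qed

text \<open>
  The error bound makes half of \<open>g z - fstar\<close> pay for the loss in the subgradient inequality
  between \<open>z\<close> and its nearest minimizer; the other half remains.
\<close>

lemma half_tube_subgradient_points_away:
  assumes z: "z \<in> half_tube" and \<zeta>: "\<zeta> \<in> clarke_subdiff f z"
    and p: "p \<in> Xstar" "infdist z Xstar = dist z p"
  shows "(g z - fstar) / 2 \<le> \<zeta> \<bullet> (z - p)"
proof -
  have mem: "z \<in> X" "z \<in> X'" "p \<in> X'"
    using z p X(3) by (auto simp: half_tube_iff minimizers_def)
  have "g z + \<zeta> \<bullet> (p - z) - \<rho> * norm (p - z) powr (1 + \<nu>) \<le> g p"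
    using paraconvex_clarke_subgradient_inequality
      [OF paraconvex_g X'(1,2) _ _ f_eq_g mem(2,3) \<zeta>] params by simp
  then have "g z - fstar - \<rho> * dist z p powr (1 + \<nu>) \<le> \<zeta> \<bullet> (z - p)"
    using g_minimizer[OF p(1)] by (simp add: dist_norm norm_minus_commute inner_diff_right)
  moreover have "\<rho> * dist z p powr (1 + \<nu>) \<le> \<mu> / 2 * dist z p powr (1 / \<delta>)"
    using z p(2) params \<delta>_bounds
    by (intro half_tube_error_absorbed) (auto simp: half_tube_iff)
  moreover have "\<mu> * dist z p powr (1 / \<delta>) \<le> g z - fstar"
    using error_bound_g[OF mem(1)] p(2) by simp
  ultimately show ?thesis by (simp add: field_simps)
qed

lemma nearest_minimizer:
  obtains p where "p \<in> Xstar" "infdist z Xstar = dist z p"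
  using infdist_attains_inf[OF closed_minimizers minimizers_nonempty] by metis

lemma half_tube_zero_subgradient:
  assumes "z \<in> half_tube" "0 \<in> clarke_subdiff f z"
  shows "g z = fstar"
proof -
  obtain p where "p \<in> Xstar" "infdist z Xstar = dist z p"
    by (rule nearest_minimizer)
  from half_tube_subgradient_points_away[OF assms this] have "g z \<le> fstar" by simp
  moreover have "fstar \<le> g z"
    using assms(1) by (intro fstar_le) (simp add: half_tube_iff)
  ultimately show ?thesis by simp
qed

text \<open>
  Moving towards the nearest minimizer \<open>p\<close> of the old point bounds the new distance to the whole
  set of minimizers. Normalizing the subgradient divides the gain by its norm, hence by at
  most \<open>L\<close>.
\<close>

lemma half_tube_step:
  assumes z: "z \<in> half_tube" and \<zeta>: "\<zeta> \<in> clarke_subdiff f z" "\<zeta> \<noteq> 0" "norm \<zeta> \<le> L"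
    and "0 \<le> a"
  shows "(infdist (closest_point X (z - (a / norm \<zeta>) *\<^sub>R \<zeta>)) Xstar)\<^sup>2
    \<le> (infdist z Xstar)\<^sup>2 - a * ((g z - fstar) / L) + a\<^sup>2"
proof -
  obtain p where p: "p \<in> Xstar" "infdist z Xstar = dist z p"
    by (rule nearest_minimizer)
  have mem: "p \<in> X" "z \<in> X"
    using p z by (auto simp: minimizers_def half_tube_iff)
  let ?z' = "closest_point X (z - (a / norm \<zeta>) *\<^sub>R \<zeta>)"
  have "(infdist ?z' Xstar)\<^sup>2 \<le> (dist ?z' p)\<^sup>2"
    using p(1) by (intro power_mono infdist_le infdist_nonneg)
  also have "\<dots> \<le> (dist z p)\<^sup>2 - 2 * (a / norm \<zeta>) * (\<zeta> \<bullet> (z - p)) + a\<^sup>2"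
    using X mem \<zeta> by (intro projected_step_distance)
  finally have step: "(infdist ?z' Xstar)\<^sup>2
    \<le> (infdist z Xstar)\<^sup>2 - 2 * (a / norm \<zeta>) * (\<zeta> \<bullet> (z - p)) + a\<^sup>2"
    unfolding p(2) .
  have "a * ((g z - fstar) / L) \<le> a * ((g z - fstar) / norm \<zeta>)"
    using \<open>0 \<le> a\<close> fstar_le[OF mem(2)] \<zeta>(2,3) less_le_trans[of 0 "norm \<zeta>" L]
    by (intro mult_left_mono divide_left_mono mult_pos_pos) auto
  also have "\<dots> = 2 * (a / norm \<zeta>) * ((g z - fstar) / 2)"
    by simp
  also have "\<dots> \<le> 2 * (a / norm \<zeta>) * (\<zeta> \<bullet> (z - p))"
    using half_tube_subgradient_points_away[OF z \<zeta>(1) p] \<open>0 \<le> a\<close>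
    by (intro mult_left_mono) auto
  finally show ?thesis using step by linarith
qed

text \<open>
  The tube has radius \<open>s powr \<delta>\<close>, where \<open>s\<close> is the power that occurs in the bound on the step
  size. This puts the claim into the form of \<open>step_bound_below_radius\<close> with \<open>m = \<mu> / L\<close>.
\<close>

lemma half_tube_step_stays:
  assumes z: "z \<in> half_tube" and \<zeta>: "\<zeta> \<in> clarke_subdiff f z" "\<zeta> \<noteq> 0" "norm \<zeta> \<le> L"
    and "0 < L" and "0 < a"
    and a: "a < min 1 (min 1 (\<mu> / L) * (\<mu> / (2 * \<rho>)) powr (1 / (\<delta> * (1 + \<nu>) - 1)))"
  shows "closest_point X (z - (a / norm \<zeta>) *\<^sub>R \<zeta>) \<in> half_tube"
proof -
  define s where "s = (\<mu> / (2 * \<rho>)) powr (1 / (\<delta> * (1 + \<nu>) - 1))"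
  define d where "d = infdist z Xstar"
  let ?z' = "closest_point X (z - (a / norm \<zeta>) *\<^sub>R \<zeta>)"
  have radius: "(\<mu> / (2 * \<rho>)) powr (\<delta> / (\<delta> * (1 + \<nu>) - 1)) = s powr \<delta>"
    by (simp add: s_def powr_powr)
  have "0 < s" using params by (simp add: s_def)
  have a_bounds: "a < 1" "a < s" "a < \<mu> / L * s"
  proof -
    show "a < 1" using a by simp
    have "min 1 (\<mu> / L) * s \<le> 1 * s" "min 1 (\<mu> / L) * s \<le> \<mu> / L * s"
      using \<open>0 < s\<close> by (intro mult_right_mono; simp)+
    then show "a < s" "a < \<mu> / L * s" using a by (auto simp: s_def)
  qed
  have "z \<in> X" "d < s powr \<delta>"
    using z by (auto simp: half_tube_iff radius d_def)
  have "(infdist ?z' Xstar)\<^sup>2 \<le> d\<^sup>2 - a * ((g z - fstar) / L) + a\<^sup>2"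
    unfolding d_def using half_tube_step[OF z \<zeta>] \<open>0 < a\<close> by simp
  also have "\<dots> \<le> d\<^sup>2 - a * (\<mu> / L * d powr (1 / \<delta>)) + a\<^sup>2"
  proof -
    have "\<mu> * d powr (1 / \<delta>) / L \<le> (g z - fstar) / L"
      using error_bound_g[OF \<open>z \<in> X\<close>] \<open>0 < L\<close> by (simp add: d_def divide_right_mono)
    then have "a * (\<mu> * d powr (1 / \<delta>) / L) \<le> a * ((g z - fstar) / L)"
      using \<open>0 < a\<close> by (intro mult_left_mono) auto
    then show ?thesis by simp
  qed
  also have "\<dots> < (s powr \<delta>)\<^sup>2"
    using \<open>d < s powr \<delta>\<close> \<open>0 < s\<close> \<delta>_bounds params(5) \<open>0 < a\<close> a_bounds
    by (intro step_bound_below_radius) (auto simp: d_def infdist_nonneg)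
  finally have "infdist ?z' Xstar < s powr \<delta>"
    by (rule power_less_imp_less_base) simp
  moreover have "?z' \<in> X"
    using X(1) \<open>z \<in> X\<close> by (intro closest_point_in_set) auto
  ultimately show ?thesis by (simp add: half_tube_iff radius)
qed

section \<open>Convergence of the projected subgradient method\<close>

text \<open>
  While the values stay above \<open>fstar + e\<close>, the subgradients cannot vanish, so every iteration
  is a genuine step and lowers the squared distance by at least \<open>e / L * \<alpha> k - (\<alpha> k)\<^sup>2\<close>. This
  cannot go on for ever.
\<close>

lemma subgradient_iterates_near_optimal:
  assumes L: "\<And>z \<zeta>. z \<in> half_tube \<Longrightarrow> \<zeta> \<in> clarke_subdiff f z \<Longrightarrow> norm \<zeta> \<le> L" and "0 < L"
    and seq: "projected_subgradient_seq f X \<alpha> x" and "x 1 \<in> half_tube"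
    and \<alpha>: "nonsummable_diminishing \<alpha>"
    and bound: "\<And>k. k \<ge> 1 \<Longrightarrow> 0 < \<alpha> k \<and>
           \<alpha> k < min 1 (min 1 (\<mu> / L) * (\<mu> / (2 * \<rho>)) powr (1 / (\<delta> * (1 + \<nu>) - 1)))"
  shows "\<And>k. k \<ge> 1 \<Longrightarrow> x k \<in> half_tube"
    and "\<And>e K. 0 < e \<Longrightarrow> \<exists>k\<ge>K. k \<ge> 1 \<and> g (x k) < fstar + e"
proof -
  have "\<exists>\<zeta>. k \<ge> 1 \<longrightarrow> \<zeta> \<in> clarke_subdiff f (x k) \<and> x (Suc k) = (if \<zeta> = 0 then x k
      else closest_point X (x k - (\<alpha> k / norm \<zeta>) *\<^sub>R \<zeta>))" for k
    using seq unfolding projected_subgradient_seq_def by blast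
  then obtain \<zeta> where \<zeta>: "\<And>k. k \<ge> 1 \<Longrightarrow> \<zeta> k \<in> clarke_subdiff f (x k)"
    and x_Suc: "\<And>k. k \<ge> 1 \<Longrightarrow> x (Suc k) = (if \<zeta> k = 0 then x k
      else closest_point X (x k - (\<alpha> k / norm (\<zeta> k)) *\<^sub>R \<zeta> k))"
    by metis
  show tube: "x k \<in> half_tube" if "k \<ge> 1" for k
    using that
  proof (induction k rule: dec_induct)
    case base
    then show ?case by (fact \<open>x 1 \<in> half_tube\<close>)
  next
    case (step k)
    then show ?case
      using half_tube_step_stays[OF _ \<zeta> _ L \<open>0 < L\<close>] bound \<zeta> x_Suc by auto
  qed
  show "\<exists>k\<ge>K. k \<ge> 1 \<and> g (x k) < fstar + e" if "0 < e" for e K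
  proof (rule ccontr)
    assume "\<not> ?thesis"
    then have far: "fstar + e \<le> g (x k)" if "k \<ge> max K 1" for k
      using that by (meson max.boundedE not_le)
    have "(infdist (x (Suc k)) Xstar)\<^sup>2 \<le> (infdist (x k) Xstar)\<^sup>2 - e / L * \<alpha> k + (\<alpha> k)\<^sup>2"
      if k: "k \<ge> max K 1" for k
    proof -
      have "k \<ge> 1" using k by simp
      have "\<zeta> k \<noteq> 0"
        using half_tube_zero_subgradient[OF tube] \<zeta> far[OF k] \<open>0 < e\<close> \<open>k \<ge> 1\<close> by force
      then have "(infdist (x (Suc k)) Xstar)\<^sup>2
          \<le> (infdist (x k) Xstar)\<^sup>2 - \<alpha> k * ((g (x k) - fstar) / L) + (\<alpha> k)\<^sup>2"
        using half_tube_step[OF tube[of k] \<zeta>[of k] _ L[OF tube[of k] \<zeta>[of k]], of "\<alpha> k"]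
          bound[of k] x_Suc[of k] \<open>k \<ge> 1\<close> by auto
      moreover have "\<alpha> k * (e / L) \<le> \<alpha> k * ((g (x k) - fstar) / L)"
        using far[OF k] bound[of k] \<open>k \<ge> 1\<close> \<open>0 < L\<close>
        by (intro mult_left_mono divide_right_mono) auto
      ultimately show ?thesis by (simp add: mult.commute)
    qed
    then show False
      using nonsummable_steps_no_uniform_decrease
        [OF \<alpha>, of "e / L" "\<lambda>k. (infdist (x k) Xstar)\<^sup>2" "max K 1"] \<open>0 < e\<close> \<open>0 < L\<close>
      by simp
  qed
qed

lemma infdist_small_if_near_optimal:
  assumes "z \<in> X" "0 < e" "g z < fstar + \<mu> * e powr (1 / \<delta>)"
  shows "infdist z Xstar < e"
proof (rule ccontr)
  assume "\<not> infdist z Xstar < e"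
  then have "\<mu> * e powr (1 / \<delta>) \<le> \<mu> * infdist z Xstar powr (1 / \<delta>)"
    using assms(2) params(6) \<delta>_bounds by (intro mult_left_mono powr_mono2) auto
  with error_bound_g[OF assms(1)] assms(3) show False by simp
qed

end

theorem theorem4p6:
  fixes f :: "real ^ 'n \<Rightarrow> ereal"
    and X X' :: "(real ^ 'n) set"
    and \<rho> \<nu> \<delta> \<mu> L :: real
    and \<alpha> :: "nat \<Rightarrow> real"
    and x :: "nat \<Rightarrow> real ^ 'n"
  assumes "proper_fun f"
    and "X \<subseteq> eff_dom f" "X \<noteq> {}" "closed X" "convex X"
    and "minimizers f X \<noteq> {}"
    and "\<rho> > 0" "0 < \<nu>" "\<nu> \<le> 1" "1 / (1 + \<nu>) < \<delta>" "\<delta> \<le> 1" "\<mu> > 0"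
    and "open X'" "convex X'" "X \<subseteq> X'" "X' \<subseteq> eff_dom f"
    and "paraconvex_on \<nu> \<rho> X' f"
    and "holder_error_bound \<mu> \<delta> f X"
    and "ereal L = Sup {ereal (norm \<zeta>) | \<zeta> z. z \<in> tube \<nu> \<rho> \<delta> \<mu> f X 1 \<and> \<zeta> \<in> clarke_subdiff f z}"
    and "L > 0"
    and "projected_subgradient_seq f X \<alpha> x"
    and "x 1 \<in> tube \<nu> \<rho> \<delta> \<mu> f X (1 / 2)"
    and "nonsummable_diminishing \<alpha>"
    and "\<And>k. k \<ge> 1 \<Longrightarrow> 0 < \<alpha> k \<and>
           \<alpha> k < min 1 (min 1 (\<mu> / L) * (\<mu> / (2 * \<rho>)) powr (1 / (\<delta> * (1 + \<nu>) - 1)))"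
  shows "(\<lambda>k. Min ((\<lambda>i. f (x i)) ` {1..k})) \<longlonglongrightarrow> min_value f X
    \<and> liminf (\<lambda>k. f (x k)) = min_value f X
    \<and> liminf (\<lambda>k. ereal (infdist (x k) (minimizers f X))) = 0
    \<and> (bounded (x ` {1..}) \<longrightarrow>
         (\<exists>xstar \<in> minimizers f X. \<exists>r. strict_mono r \<and> r 0 \<ge> 1 \<and> (x \<circ> r) \<longlonglongrightarrow> xstar))"
proof -
  interpret paraconvex_error_bound f X X' \<rho> \<nu> \<delta> \<mu>
    using assms by unfold_locales
  have L: "norm \<zeta> \<le> L" if "z \<in> half_tube" "\<zeta> \<in> clarke_subdiff f z" for z \<zeta>
  proof -
    have "ereal (norm \<zeta>) \<le> ereal L"
      unfolding assms(19) using that half_tube_subset by (intro Sup_upper) blast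
    then show ?thesis by simp
  qed
  have tube: "x k \<in> half_tube" if "k \<ge> 1" for k
    using subgradient_iterates_near_optimal(1)[OF L assms(20-24) that] .
  have near: "\<exists>k\<ge>K. k \<ge> 1 \<and> g (x k) < fstar + e" if "0 < e" for e K
    using subgradient_iterates_near_optimal(2)[OF L assms(20-24) that] .
  have in_X: "x k \<in> X" and f_x: "f (x k) = ereal (g (x k))" if "k \<ge> 1" for k
    using tube[OF that] X(3) f_eq_g by (auto simp: half_tube_iff)
  have value_bound: "ereal fstar \<le> f (x k)" if "k \<ge> 1" for k
    using fstar_le[OF in_X[OF that]] f_x[OF that] by simp
  have value_near: "\<exists>k\<ge>K. f (x k) < ereal (fstar + e)" if "0 < e" for e K
    using near[OF that, of K] f_x by force
  have dist_near: "\<exists>k\<ge>K. ereal (infdist (x k) Xstar) < ereal (0 + e)" if "0 < e" for e K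
  proof -
    have "0 < \<mu> * e powr (1 / \<delta>)" using params that by simp
    from near[OF this, of K] show ?thesis
      using infdist_small_if_near_optimal in_X that by force
  qed
  have "liminf (\<lambda>k. ereal (infdist (x k) Xstar)) = ereal 0"
    using dist_near by (intro liminf_eq_attained_bound) (auto simp: infdist_nonneg)
  then have liminf_dist: "liminf (\<lambda>k. ereal (infdist (x k) Xstar)) = 0"
    by (simp add: zero_ereal_def)
  show ?thesis
    using running_min_tendsto[of fstar "\<lambda>k. f (x k)", OF value_bound value_near]
      liminf_eq_attained_bound[of fstar "\<lambda>k. f (x k)", OF value_bound value_near]
      liminf_dist
      bounded_subsequence_to_closed_set[OF closed_minimizers minimizers_nonempty _ liminf_dist]
    by (simp add: min_value_eq)
qed

end
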